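(* Let $\zeta,\zeta'\ge0$ be the optimal objective values of the continuous relaxations of formulation (SPP-F1) and formulation (SPP-F2), respectively. Then $\zeta\le\zeta'$.
   Context: Setting. $P_1,\dots,P_m\subseteq\mathbb{R}^d$ are the cells of a polyhedral subdivision, with $\mathrm{int}(P_i)\cap\mathrm{int}(P_j)=\emptyset$ for $i\ne j$; the cells are assumed to be polytopes. Cell $P_i$ is endowed with the $\ell_{p_i}$-norm $\|\cdot\|_{p_i}$, $1\le p_i\le+\infty$, and a weight $\omega_i>0$. The undirected graph $G=(V,E)$ has $V=\{1,\dots,m\}$ and $\{i,j\}\in E$ ($i\ne j$) iff $P_i$ and $P_j$ have a common (nonempty) face; for $\{i,j\}\in E$, $F_{ij}=F_{ji}=P_i\cap P_j$ is their maximal common face. $\mathrm{Ext}(\cdot)$ denotes the set of extreme points of a polytope; $\mathrm{Ext}(F_{ij})=\mathrm{Ext}(P_i)\cap \mathrm{Ext}(P_j)$. $A=\{(i,j),(j,i):\{i,j\}\in E\}$. In sums such as $\sum_{(i,j)\in A}$ or $\sum_{(h,i)\in A}$ with $i$ fixed, the sum runs over all $j$ (resp. $h$) for which the pair is an arc. Points $x_s\in P_s$, $x_t\in P_t$ with $s\ne t$ are given. Common constraints (C): - $\sum_{(s,j)\in A} z_{sj}-\sum_{(h,s)\in A} z_{hs}=1$; - $\sum_{(i,j)\in A} z_{ij}-\sum_{(h,i)\in A} z_{hi}=0$ for all $i\in V\setminus\{s,t\}$; - $\sum_{(t,j)\in A} z_{tj}-\sum_{(h,t)\in A} z_{ht}=-1$;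 - $\sum_{(h,i)\in A} z_{hi}\le 1$ and $\sum_{(i,j)\in A} z_{ij}\le 1$ for all $i\in V$; - $\sum_{e\in \mathrm{Ext}(F_{ij})}\lambda_{ije}=z_{ij}$ for all $(i,j)\in A$; - $d_i\ge0$ for all $i\in V$; $z_{ij}\in\{0,1\}$ for all $(i,j)\in A$; $\lambda_{ije}\ge0$ for all $(i,j)\in A$, $e\in \mathrm{Ext}(F_{ij})$. Formulation (SPP-F1): minimize $\sum_{i\in V}\omega_i d_i$ over $(d,z,\lambda)$ subject to (C) and - $d_s\ge \big\|\sum_{(s,j)\in A}\sum_{e\in \mathrm{Ext}(F_{sj})}\lambda_{sje}e-x_s\big\|_{p_s}$; - $d_i\ge \big\|\sum_{(i,j)\in A}\sum_{e\in \mathrm{Ext}(F_{ij})}\lambda_{ije}e-\sum_{(h,i)\in A}\sum_{e\in \mathrm{Ext}(F_{hi})}\lambda_{hie}e\big\|_{p_i}$ for all $i\in V\setminus\{s,t\}$; - $d_t\ge \big\|x_t-\sum_{(h,t)\in A}\sum_{e\in \mathrm{Ext}(F_{ht})}\lambda_{hte}e\big\|_{p_t}$. Formulation (SPP-F2): minimize $\sum_{i\in V}\omega_i d_i$ over $(d,z,\lambda,\rho,\Phi,\Psi)$ subject to (C) and - $d_s\ge \sum_{(s,j)\in A}\big\|\sum_{e\in \mathrm{Ext}(F_{sj})}\lambda_{sje}e-x_s z_{sj}\big\|_{p_s}$; - $d_i\ge \sum_{(h,i)\in A}\sum_{(i,j)\in A}\big\|\sum_{e\in \mathrm{Ext}(F_{ij})}\Psi_{hije}e-\sum_{e\in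 \mathrm{Ext}(F_{hi})}\Phi_{hije}e\big\|_{p_i}$ for all $i\in V\setminus\{s,t\}$; - $d_t\ge \sum_{(h,t)\in A}\big\|x_t z_{ht}-\sum_{e\in \mathrm{Ext}(F_{ht})}\lambda_{hte}e\big\|_{p_t}$; and, for all $i\in V\setminus\{s,t\}$: - $\sum_{(i,j)\in A}\rho_{hij}=z_{hi}$ for all $(h,i)\in A$; $\sum_{(h,i)\in A}\rho_{hij}=z_{ij}$ for all $(i,j)\in A$; - $\sum_{e\in \mathrm{Ext}(F_{hi})}\Phi_{hije}=\rho_{hij}$ and $\sum_{e\in \mathrm{Ext}(F_{ij})}\Psi_{hije}=\rho_{hij}$ for all $(h,i),(i,j)\in A$; - $\sum_{(i,j)\in A}\Phi_{hije}=\lambda_{hie}$ for all $(h,i)\in A$, $e\in \mathrm{Ext}(F_{hi})$; - $\sum_{(h,i)\in A}\Psi_{hije}=\lambda_{ije}$ for all $(i,j)\in A$, $e\in \mathrm{Ext}(F_{ij})$; - $\rho_{hij}\ge0$, $\Phi_{hije}\ge0$ ($e\in \mathrm{Ext}(F_{hi})$), $\Psi_{hije}\ge0$ ($e\in \mathrm{Ext}(F_{ij})$) for all $(h,i),(i,j)\in A$. The continuous relaxation of a formulation is obtained by replacing the integrality constraints $z_{ij}\in\{0,1\}$ by $0\le z_{ij}\le1$. An infeasible minimization problem has value $+\infty$. *)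

theory Defs
  imports "HOL-Analysis.Analysis"
begin

definition lp_norm :: "ereal \<Rightarrow> real^'n \<Rightarrow> real" where
  "lp_norm p x =
     (if p = \<infinity> then infnorm x
      else (\<Sum>k\<in>UNIV. \<bar>x $ k\<bar> powr real_of_ereal p) powr (1 / real_of_ereal p))"

text \<open>The cells are indexed by a set \<open>V\<close>. As \<^term>\<open>{}\<close> is a face of every set, the
  face-to-face condition also covers disjoint cells.\<close>

definition polyhedral_subdivision :: "nat set \<Rightarrow> (nat \<Rightarrow> (real^'n) set) \<Rightarrow> bool" where
  "polyhedral_subdivision V P \<longleftrightarrow>
     (\<forall>i\<in>V. polytope (P i)) \<and>
     (\<forall>i\<in>V. \<forall>j\<in>V. i \<noteq> j \<longrightarrow>
        interior (P i) \<inter> interior (P j) = {} \<and>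
        (P i \<inter> P j) face_of P i \<and> (P i \<inter> P j) face_of P j)"

definition edges :: "nat set \<Rightarrow> (nat \<Rightarrow> (real^'n) set) \<Rightarrow> nat set set" where
  "edges V P = {{i, j} | i j. i \<in> V \<and> j \<in> V \<and> i \<noteq> j \<and>
                  (\<exists>F. F \<noteq> {} \<and> F face_of P i \<and> F face_of P j)}"

definition arcs :: "nat set \<Rightarrow> (nat \<Rightarrow> (real^'n) set) \<Rightarrow> (nat \<times> nat) set" where
  "arcs V P = {(i, j). {i, j} \<in> edges V P}"

definition Ext :: "(real^'n) set \<Rightarrow> (real^'n) set" where
  "Ext S = {e. e extreme_point_of S}"

definition common_face :: "(nat \<Rightarrow> (real^'n) set) \<Rightarrow> nat \<Rightarrow> nat \<Rightarrow> (real^'n) set" where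
  "common_face P i j = P i \<inter> P j"

text \<open>The set \<open>D\<close> is the domain of the arc variables \<open>z\<close>: \<^term>\<open>{0, 1}\<close> gives the
  mixed-integer formulation, \<^term>\<open>{0..1}\<close> its continuous relaxation. Variables with indices
  outside the ranges of the formulation occur in no constraint and not in the objective.\<close>

definition common_constraints ::
  "real set \<Rightarrow> nat set \<Rightarrow> (nat \<Rightarrow> (real^'n) set) \<Rightarrow> nat \<Rightarrow> nat \<Rightarrow>
   (nat \<Rightarrow> real) \<Rightarrow> (nat \<Rightarrow> nat \<Rightarrow> real) \<Rightarrow> (nat \<Rightarrow> nat \<Rightarrow> real^'n \<Rightarrow> real) \<Rightarrow> bool" where
  "common_constraints D V P s t d z lam \<longleftrightarrow>
     (let A = arcs V P; F = common_face P in
      (\<Sum>j | (s, j) \<in> A. z s j) - (\<Sum>h | (h, s) \<in> A. z h s) = 1 \<and>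
      (\<forall>i \<in> V - {s, t}. (\<Sum>j | (i, j) \<in> A. z i j) - (\<Sum>h | (h, i) \<in> A. z h i) = 0) \<and>
      (\<Sum>j | (t, j) \<in> A. z t j) - (\<Sum>h | (h, t) \<in> A. z h t) = -1 \<and>
      (\<forall>i \<in> V. (\<Sum>h | (h, i) \<in> A. z h i) \<le> 1) \<and>
      (\<forall>i \<in> V. (\<Sum>j | (i, j) \<in> A. z i j) \<le> 1) \<and>
      (\<forall>(i, j) \<in> A. (\<Sum>e \<in> Ext (F i j). lam i j e) = z i j) \<and>
      (\<forall>i \<in> V. 0 \<le> d i) \<and>
      (\<forall>(i, j) \<in> A. z i j \<in> D) \<and>
      (\<forall>(i, j) \<in> A. \<forall>e \<in> Ext (F i j). 0 \<le> lam i j e))"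

definition F1_feasible ::
  "real set \<Rightarrow> nat set \<Rightarrow> (nat \<Rightarrow> (real^'n) set) \<Rightarrow> (nat \<Rightarrow> ereal) \<Rightarrow>
   nat \<Rightarrow> nat \<Rightarrow> real^'n \<Rightarrow> real^'n \<Rightarrow>
   (nat \<Rightarrow> real) \<Rightarrow> (nat \<Rightarrow> nat \<Rightarrow> real) \<Rightarrow> (nat \<Rightarrow> nat \<Rightarrow> real^'n \<Rightarrow> real) \<Rightarrow> bool" where
  "F1_feasible D V P p s t xs xt d z lam \<longleftrightarrow>
     common_constraints D V P s t d z lam \<and>
     (let A = arcs V P; F = common_face P in
      d s \<ge> lp_norm (p s)
              ((\<Sum>j | (s, j) \<in> A. \<Sum>e \<in> Ext (F s j). lam s j e *\<^sub>R e) - xs) \<and>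
      (\<forall>i \<in> V - {s, t}.
        d i \<ge> lp_norm (p i)
                ((\<Sum>j | (i, j) \<in> A. \<Sum>e \<in> Ext (F i j). lam i j e *\<^sub>R e) -
                 (\<Sum>h | (h, i) \<in> A. \<Sum>e \<in> Ext (F h i). lam h i e *\<^sub>R e))) \<and>
      d t \<ge> lp_norm (p t)
              (xt - (\<Sum>h | (h, t) \<in> A. \<Sum>e \<in> Ext (F h t). lam h t e *\<^sub>R e)))"

definition F2_feasible ::
  "real set \<Rightarrow> nat set \<Rightarrow> (nat \<Rightarrow> (real^'n) set) \<Rightarrow> (nat \<Rightarrow> ereal) \<Rightarrow>
   nat \<Rightarrow> nat \<Rightarrow> real^'n \<Rightarrow> real^'n \<Rightarrow>
   (nat \<Rightarrow> real) \<Rightarrow> (nat \<Rightarrow> nat \<Rightarrow> real) \<Rightarrow> (nat \<Rightarrow> nat \<Rightarrow> real^'n \<Rightarrow> real) \<Rightarrow>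
   (nat \<Rightarrow> nat \<Rightarrow> nat \<Rightarrow> real) \<Rightarrow>
   (nat \<Rightarrow> nat \<Rightarrow> nat \<Rightarrow> real^'n \<Rightarrow> real) \<Rightarrow> (nat \<Rightarrow> nat \<Rightarrow> nat \<Rightarrow> real^'n \<Rightarrow> real) \<Rightarrow> bool" where
  "F2_feasible D V P p s t xs xt d z lam \<rho> \<Phi> \<Psi> \<longleftrightarrow>
     common_constraints D V P s t d z lam \<and>
     (let A = arcs V P; F = common_face P in
      d s \<ge> (\<Sum>j | (s, j) \<in> A.
               lp_norm (p s) ((\<Sum>e \<in> Ext (F s j). lam s j e *\<^sub>R e) - z s j *\<^sub>R xs)) \<and>
      (\<forall>i \<in> V - {s, t}.
        d i \<ge> (\<Sum>h | (h, i) \<in> A. \<Sum>j | (i, j) \<in> A.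
                 lp_norm (p i) ((\<Sum>e \<in> Ext (F i j). \<Psi> h i j e *\<^sub>R e) -
                                (\<Sum>e \<in> Ext (F h i). \<Phi> h i j e *\<^sub>R e)))) \<and>
      d t \<ge> (\<Sum>h | (h, t) \<in> A.
               lp_norm (p t) (z h t *\<^sub>R xt - (\<Sum>e \<in> Ext (F h t). lam h t e *\<^sub>R e))) \<and>
      (\<forall>i \<in> V - {s, t}.
        (\<forall>h. (h, i) \<in> A \<longrightarrow> (\<Sum>j | (i, j) \<in> A. \<rho> h i j) = z h i) \<and>
        (\<forall>j. (i, j) \<in> A \<longrightarrow> (\<Sum>h | (h, i) \<in> A. \<rho> h i j) = z i j) \<and>
        (\<forall>h j. (h, i) \<in> A \<and> (i, j) \<in> A \<longrightarrow>
           (\<Sum>e \<in> Ext (F h i). \<Phi> h i j e) = \<rho> h i j \<and>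
           (\<Sum>e \<in> Ext (F i j). \<Psi> h i j e) = \<rho> h i j) \<and>
        (\<forall>h. (h, i) \<in> A \<longrightarrow>
           (\<forall>e \<in> Ext (F h i). (\<Sum>j | (i, j) \<in> A. \<Phi> h i j e) = lam h i e)) \<and>
        (\<forall>j. (i, j) \<in> A \<longrightarrow>
           (\<forall>e \<in> Ext (F i j). (\<Sum>h | (h, i) \<in> A. \<Psi> h i j e) = lam i j e)) \<and>
        (\<forall>h j. (h, i) \<in> A \<and> (i, j) \<in> A \<longrightarrow>
           0 \<le> \<rho> h i j \<and>
           (\<forall>e \<in> Ext (F h i). 0 \<le> \<Phi> h i j e) \<and>
           (\<forall>e \<in> Ext (F i j). 0 \<le> \<Psi> h i j e))))"

text \<open>Optimal values are infima in the extended reals, so that an infeasible problem has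
  value \<^term>\<open>\<infinity> :: ereal\<close>.\<close>

definition F1_value ::
  "real set \<Rightarrow> nat set \<Rightarrow> (nat \<Rightarrow> (real^'n) set) \<Rightarrow> (nat \<Rightarrow> ereal) \<Rightarrow> (nat \<Rightarrow> real) \<Rightarrow>
   nat \<Rightarrow> nat \<Rightarrow> real^'n \<Rightarrow> real^'n \<Rightarrow> ereal" where
  "F1_value D V P p \<omega> s t xs xt =
     Inf {ereal (\<Sum>i\<in>V. \<omega> i * d i) | d z lam. F1_feasible D V P p s t xs xt d z lam}"

definition F2_value ::
  "real set \<Rightarrow> nat set \<Rightarrow> (nat \<Rightarrow> (real^'n) set) \<Rightarrow> (nat \<Rightarrow> ereal) \<Rightarrow> (nat \<Rightarrow> real) \<Rightarrow>
   nat \<Rightarrow> nat \<Rightarrow> real^'n \<Rightarrow> real^'n \<Rightarrow> ereal" where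
  "F2_value D V P p \<omega> s t xs xt =
     Inf {ereal (\<Sum>i\<in>V. \<omega> i * d i) | d z lam \<rho> \<Phi> \<Psi>.
            F2_feasible D V P p s t xs xt d z lam \<rho> \<Phi> \<Psi>}"

definition SPP_F1 where "SPP_F1 = F1_value {0, 1}"
definition SPP_F2 where "SPP_F2 = F2_value {0, 1}"
definition SPP_F1_relaxation where "SPP_F1_relaxation = F1_value {0..1}"
definition SPP_F2_relaxation where "SPP_F2_relaxation = F2_value {0..1}"

end

theory Submission imports Defs begin

text \<open>Every point feasible for the relaxation of (SPP-F2) is, after forgetting \<open>\<rho>, \<Phi>, \<Psi>\<close>,
  feasible for that of (SPP-F1). At an intermediate cell, \<open>\<lambda>\<close> is a marginal of \<open>\<Phi>\<close> and of \<open>\<Psi>\<close>,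
  so the vector measured in (SPP-F1) is the sum of those measured in (SPP-F2), and the triangle
  inequality for the \<open>p\<close>-norm applies. At the end cells one also needs that \<open>s\<close> has total
  outflow 1 and \<open>t\<close> total inflow 1: the balance is \<open>\<plusminus>1\<close>, the flows are nonnegative and at
  most 1.\<close>

text \<open>At two positive points this is \<open>powr_convex\<close>. If one point is 0, its term
  vanishes and the claim becomes \<open>(c * w) powr r \<le> c * w powr r\<close>, which holds
  because \<open>c powr r \<le> c\<close> for \<open>0 < c < 1\<close> and
  \<open>1 \<le> r\<close>.\<close>

lemma convex_on_powr_atLeast_0:
  fixes r :: real
  assumes "1 \<le> r"
  shows "convex_on {0..} (\<lambda>x. x powr r)"
proof (rule convex_onI)
  fix t x y :: real
  assume t: "0 < t" "t < 1" and xy: "x \<in> {0..}" "y \<in> {0..}"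
  have le: "(c * w) powr r \<le> c * w powr r" if "0 < c" "c < 1" "0 \<le> w" for c w :: real
  proof -
    have "c powr r \<le> c"
      using powr_mono'[of 1 r c] assms that by simp
    then show ?thesis
      using that by (simp add: powr_mult mult_right_mono)
  qed
  show "((1 - t) *\<^sub>R x + t *\<^sub>R y) powr r \<le> (1 - t) * x powr r + t * y powr r"
  proof (cases "x = 0 \<or> y = 0")
    case True
    then show ?thesis
      using le[of t y] le[of "1 - t" x] t xy assms by auto
  next
    case False
    then show ?thesis
      using convex_onD[OF powr_convex[OF assms], of t x y] t xy by auto
  qed
qed simp

text \<open>Minkowski's inequality by normalisation: \<open>f\<close> and \<open>g\<close> are
  divided by their norms \<open>a\<close> and \<open>b\<close>, convexity of \<open>x powr r\<close>
  is applied entry by entry, and the results are summed.\<close>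

lemma Minkowski_sum:
  fixes f g :: "'a \<Rightarrow> real" and r :: real
  assumes fin: "finite I" and r: "1 \<le> r"
  shows "(\<Sum>k\<in>I. \<bar>f k + g k\<bar> powr r) powr (1 / r) \<le>
           (\<Sum>k\<in>I. \<bar>f k\<bar> powr r) powr (1 / r) + (\<Sum>k\<in>I. \<bar>g k\<bar> powr r) powr (1 / r)"
    (is "_ \<le> ?a + ?b")
proof -
  \<comment> \<open>Settles the degenerate cases \<open>a = 0\<close> and \<open>b = 0\<close>, in
    which normalising would divide by zero.\<close>
  have vanish: "h k = 0" if "(\<Sum>k\<in>I. \<bar>h k\<bar> powr r) powr (1 / r) = 0" "k \<in> I" for h :: "'a \<Rightarrow> real" and k
    using that fin by (auto simp: sum_nonneg_eq_0_iff)
  define a b where "a = ?a" and "b = ?b"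
  have "0 \<le> a" "0 \<le> b"
    by (simp_all add: a_def b_def)
  then consider "a = 0" | "b = 0" | "0 < a" "0 < b"
    by linarith
  then show ?thesis
  proof cases
    case 1
    then have "f k = 0" if "k \<in> I" for k
      using vanish[of f k] that by (simp only: a_def)
    then show ?thesis by simp
  next
    case 2
    then have "g k = 0" if "k \<in> I" for k
      using vanish[of g k] that by (simp only: b_def)
    then show ?thesis by simp
  next
    case pos: 3
    have apow: "(\<Sum>k\<in>I. \<bar>f k\<bar> powr r) = a powr r" "(\<Sum>k\<in>I. \<bar>g k\<bar> powr r) = b powr r"
      using r by (simp_all add: a_def b_def powr_powr sum_nonneg)
    \<comment> \<open>convexity at the convex combination of \<open>u / a\<close> and \<open>v / b\<close> with weights
      \<open>a / (a + b)\<close> and \<open>b / (a + b)\<close>\<close>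
    have pointwise: "(u + v) powr r \<le>
        (a + b) powr r * (a / (a + b) * (u powr r / a powr r) + b / (a + b) * (v powr r / b powr r))"
      if uv: "0 \<le> u" "0 \<le> v" for u v
    proof -
      have w: "1 - b / (a + b) = a / (a + b)"
        using pos by (simp add: field_simps)
      have "(1 - b / (a + b)) *\<^sub>R (u / a) + (b / (a + b)) *\<^sub>R (v / b) = (u + v) / (a + b)"
        unfolding w using pos by (simp add: add_divide_distrib)
      then have "((u + v) / (a + b)) powr r \<le> a / (a + b) * (u / a) powr r + b / (a + b) * (v / b) powr r"
        using convex_onD[OF convex_on_powr_atLeast_0[OF r], of "b / (a + b)" "u / a" "v / b"] pos uv w
        by simp
      then show ?thesis
        using pos uv by (simp add: powr_divide pos_divide_le_eq mult.commute)
    qed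
    have "(\<Sum>k\<in>I. \<bar>f k + g k\<bar> powr r) \<le> (\<Sum>k\<in>I. (\<bar>f k\<bar> + \<bar>g k\<bar>) powr r)"
      using r by (intro sum_mono powr_mono2) auto
    also have "\<dots> \<le> (\<Sum>k\<in>I. (a + b) powr r *
        (a / (a + b) * (\<bar>f k\<bar> powr r / a powr r) + b / (a + b) * (\<bar>g k\<bar> powr r / b powr r)))"
      by (intro sum_mono pointwise) auto
    also have "\<dots> = (a + b) powr r * (a / (a + b) * ((\<Sum>k\<in>I. \<bar>f k\<bar> powr r) / a powr r) +
        b / (a + b) * ((\<Sum>k\<in>I. \<bar>g k\<bar> powr r) / b powr r))"
      by (simp only: sum_distrib_left[symmetric] sum.distrib sum_divide_distrib[symmetric])
    \<comment> \<open>By \<open>apow\<close> both normalised sums equal 1, and the two weights add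
      up to 1.\<close>
    also have "\<dots> = (a + b) powr r"
      unfolding apow using pos by (simp add: add_divide_distrib[symmetric])
    finally have "(\<Sum>k\<in>I. \<bar>f k + g k\<bar> powr r) powr (1 / r) \<le> ((a + b) powr r) powr (1 / r)"
      using r by (intro powr_mono2) (auto intro: sum_nonneg)
    also have "\<dots> = a + b"
      using pos r by (simp add: powr_powr)
    finally show ?thesis
      by (simp add: a_def b_def)
  qed
qed

lemma lp_norm_zero [simp]: "lp_norm p 0 = 0"
  by (simp add: lp_norm_def infnorm_0)

lemma lp_norm_triangle:
  assumes "1 \<le> p"
  shows "lp_norm p (x + y) \<le> lp_norm p x + lp_norm p y"
proof (cases p)
  case (real r)
  then show ?thesis
    using Minkowski_sum[of UNIV r "\<lambda>k. x $ k" "\<lambda>k. y $ k"] assms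
    by (simp add: lp_norm_def)
\<comment> \<open>Left are \<infinity>, where the norm is \<open>infnorm\<close>, and -\<infinity>,
  which \<open>1 \<le> p\<close> excludes.\<close>
qed (use assms in \<open>auto simp: lp_norm_def infnorm_triangle\<close>)

text \<open>For infinite \<open>I\<close> both sums are 0 by convention, so the bound can be used on
  sets of arcs without first proving them finite.\<close>

lemma lp_norm_sum:
  assumes "1 \<le> p"
  shows "lp_norm p (\<Sum>i\<in>I. f i) \<le> (\<Sum>i\<in>I. lp_norm p (f i))"
proof (induction I rule: infinite_finite_induct)
  case (insert i I)
  then show ?case
    using lp_norm_triangle[OF assms, of "f i" "\<Sum>i\<in>I. f i"] by simp
qed simp_all

text \<open>All that matters about \<open>D\<close> is that it makes the flows nonnegative, so the
  mixed-integer domain and the relaxed one are covered together.\<close>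

lemma F2_feasible_imp_F1_feasible:
  assumes feas: "F2_feasible D V P p s t xs xt d z lam \<rho> \<Phi> \<Psi>"
    and D: "D \<subseteq> {0..}" and p: "\<And>i. i \<in> V \<Longrightarrow> 1 \<le> p i" and st: "s \<in> V" "t \<in> V"
  shows "F1_feasible D V P p s t xs xt d z lam"
proof -
  define A where "A = arcs V P"
  define F where "F = common_face P"
  have common: "common_constraints D V P s t d z lam"
    using feas by (simp add: F2_feasible_def)
  have "\<forall>(i, j) \<in> A. z i j \<in> D"
    using common unfolding common_constraints_def Let_def A_def by (elim conjE)
  with D have z_nonneg: "0 \<le> z i j" if "(i, j) \<in> A" for i j
    using that by auto
  have nonneg: "0 \<le> (\<Sum>h | (h, s) \<in> A. z h s)" "0 \<le> (\<Sum>j | (t, j) \<in> A. z t j)"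
    by (auto intro!: sum_nonneg z_nonneg)
  have "(\<Sum>j | (s, j) \<in> A. z s j) - (\<Sum>h | (h, s) \<in> A. z h s) = 1"
    "(\<Sum>j | (s, j) \<in> A. z s j) \<le> 1"
    "(\<Sum>j | (t, j) \<in> A. z t j) - (\<Sum>h | (h, t) \<in> A. z h t) = -1"
    "(\<Sum>h | (h, t) \<in> A. z h t) \<le> 1"
    using common st by (auto simp: common_constraints_def Let_def A_def)
  with nonneg have flow: "(\<Sum>j | (s, j) \<in> A. z s j) = 1" "(\<Sum>h | (h, t) \<in> A. z h t) = 1"
    by linarith+

  \<comment> \<open>As the outflow of \<open>s\<close> is 1, \<open>xs\<close> is the sum of the
    vectors \<open>z s j *\<^sub>R xs\<close> and can be distributed over the arcs leaving
    \<open>s\<close>. The inflow of \<open>t\<close> serves \<open>xt\<close> in the same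
    way.\<close>
  have "lp_norm (p s) ((\<Sum>j | (s, j) \<in> A. \<Sum>e \<in> Ext (F s j). lam s j e *\<^sub>R e) - xs) =
      lp_norm (p s) (\<Sum>j | (s, j) \<in> A. (\<Sum>e \<in> Ext (F s j). lam s j e *\<^sub>R e) - z s j *\<^sub>R xs)"
    by (simp add: sum_subtractf scaleR_left.sum[symmetric] flow)
  also have "\<dots> \<le> (\<Sum>j | (s, j) \<in> A.
      lp_norm (p s) ((\<Sum>e \<in> Ext (F s j). lam s j e *\<^sub>R e) - z s j *\<^sub>R xs))"
    by (intro lp_norm_sum p st)
  also have "\<dots> \<le> d s"
    using feas by (simp add: F2_feasible_def Let_def A_def F_def)
  finally have ds: "lp_norm (p s) ((\<Sum>j | (s, j) \<in> A. \<Sum>e \<in> Ext (F s j). lam s j e *\<^sub>R e) - xs) \<le> d s" .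

  have "lp_norm (p t) (xt - (\<Sum>h | (h, t) \<in> A. \<Sum>e \<in> Ext (F h t). lam h t e *\<^sub>R e)) =
      lp_norm (p t) (\<Sum>h | (h, t) \<in> A. z h t *\<^sub>R xt - (\<Sum>e \<in> Ext (F h t). lam h t e *\<^sub>R e))"
    by (simp add: sum_subtractf scaleR_left.sum[symmetric] flow)
  also have "\<dots> \<le> (\<Sum>h | (h, t) \<in> A.
      lp_norm (p t) (z h t *\<^sub>R xt - (\<Sum>e \<in> Ext (F h t). lam h t e *\<^sub>R e)))"
    by (intro lp_norm_sum p st)
  also have "\<dots> \<le> d t"
    using feas by (simp add: F2_feasible_def Let_def A_def F_def)
  finally have dt: "lp_norm (p t) (xt - (\<Sum>h | (h, t) \<in> A. \<Sum>e \<in> Ext (F h t). lam h t e *\<^sub>R e)) \<le> d t" .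

  have di: "lp_norm (p i) ((\<Sum>j | (i, j) \<in> A. \<Sum>e \<in> Ext (F i j). lam i j e *\<^sub>R e) -
      (\<Sum>h | (h, i) \<in> A. \<Sum>e \<in> Ext (F h i). lam h i e *\<^sub>R e)) \<le> d i" if i: "i \<in> V - {s, t}" for i
  proof -
    have Psi: "lam i j e = (\<Sum>h | (h, i) \<in> A. \<Psi> h i j e)" if "(i, j) \<in> A" "e \<in> Ext (F i j)" for j e
      using feas i that by (simp add: F2_feasible_def Let_def A_def F_def)
    have Phi: "lam h i e = (\<Sum>j | (i, j) \<in> A. \<Phi> h i j e)" if "(h, i) \<in> A" "e \<in> Ext (F h i)" for h e
      using feas i that by (simp add: F2_feasible_def Let_def A_def F_def)
    have "(\<Sum>j | (i, j) \<in> A. \<Sum>e \<in> Ext (F i j). lam i j e *\<^sub>R e) =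
        (\<Sum>j | (i, j) \<in> A. \<Sum>e \<in> Ext (F i j). \<Sum>h | (h, i) \<in> A. \<Psi> h i j e *\<^sub>R e)"
      by (intro sum.cong refl) (simp add: Psi scaleR_left.sum)
    also have "\<dots> = (\<Sum>j | (i, j) \<in> A. \<Sum>h | (h, i) \<in> A. \<Sum>e \<in> Ext (F i j). \<Psi> h i j e *\<^sub>R e)"
      by (intro sum.cong refl sum.swap)
    \<comment> \<open>Puts \<open>h\<close> outermost, the order in which the \<open>\<Phi>\<close>
      sum arises, so that the two double sums can be subtracted term by term.\<close>
    also have "\<dots> = (\<Sum>h | (h, i) \<in> A. \<Sum>j | (i, j) \<in> A. \<Sum>e \<in> Ext (F i j). \<Psi> h i j e *\<^sub>R e)"
      by (rule sum.swap)
    finally have out: "(\<Sum>j | (i, j) \<in> A. \<Sum>e \<in> Ext (F i j). lam i j e *\<^sub>R e) = \<dots>" .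
    have "(\<Sum>h | (h, i) \<in> A. \<Sum>e \<in> Ext (F h i). lam h i e *\<^sub>R e) =
        (\<Sum>h | (h, i) \<in> A. \<Sum>e \<in> Ext (F h i). \<Sum>j | (i, j) \<in> A. \<Phi> h i j e *\<^sub>R e)"
      by (intro sum.cong refl) (simp add: Phi scaleR_left.sum)
    also have "\<dots> = (\<Sum>h | (h, i) \<in> A. \<Sum>j | (i, j) \<in> A. \<Sum>e \<in> Ext (F h i). \<Phi> h i j e *\<^sub>R e)"
      by (intro sum.cong refl sum.swap)
    finally have "lp_norm (p i) ((\<Sum>j | (i, j) \<in> A. \<Sum>e \<in> Ext (F i j). lam i j e *\<^sub>R e) -
        (\<Sum>h | (h, i) \<in> A. \<Sum>e \<in> Ext (F h i). lam h i e *\<^sub>R e)) =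
      lp_norm (p i) (\<Sum>h | (h, i) \<in> A. \<Sum>j | (i, j) \<in> A.
        (\<Sum>e \<in> Ext (F i j). \<Psi> h i j e *\<^sub>R e) - (\<Sum>e \<in> Ext (F h i). \<Phi> h i j e *\<^sub>R e))"
      by (simp add: out sum_subtractf)
    also have "\<dots> \<le> (\<Sum>h | (h, i) \<in> A. \<Sum>j | (i, j) \<in> A.
        lp_norm (p i) ((\<Sum>e \<in> Ext (F i j). \<Psi> h i j e *\<^sub>R e) - (\<Sum>e \<in> Ext (F h i). \<Phi> h i j e *\<^sub>R e)))"
      \<comment> \<open>The triangle inequality is used twice: for the sum over \<open>h\<close>,
        then inside it for each sum over \<open>j\<close>.\<close>
      using i by (intro order.trans[OF lp_norm_sum] sum_mono lp_norm_sum p) auto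
    also have "\<dots> \<le> d i"
      using feas i by (simp add: F2_feasible_def Let_def A_def F_def)
    finally show ?thesis .
  qed
  show ?thesis
    using common ds dt di unfolding F1_feasible_def Let_def A_def F_def by blast
qed

text \<open>The constraints include \<open>0 \<le> d i\<close>, so 0 is a lower bound of all
  objective values; with no feasible point the infimum is \<infinity>.\<close>

lemma F1_value_nonneg:
  assumes "\<And>i. i \<in> V \<Longrightarrow> 0 \<le> \<omega> i"
  shows "0 \<le> F1_value D V P p \<omega> s t xs xt"
proof -
  have "0 \<le> (\<Sum>i\<in>V. \<omega> i * d i)" if "F1_feasible D V P p s t xs xt d z lam" for d z lam
    using that assms
    by (intro sum_nonneg mult_nonneg_nonneg)
      (auto simp: F1_feasible_def common_constraints_def Let_def)
  then show ?thesis
    unfolding F1_value_def by (auto intro!: Inf_greatest)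
qed

text \<open>The objective depends on \<open>d\<close> alone, so every value attained in the second
  formulation is attained in the first, and the infimum over a larger set is smaller. Infeasibility
  is included, the infimum of the empty set being \<infinity>.\<close>

lemma F1_value_le_F2_value:
  assumes "D \<subseteq> {0..}" "\<And>i. i \<in> V \<Longrightarrow> 1 \<le> p i" "s \<in> V" "t \<in> V"
  shows "F1_value D V P p \<omega> s t xs xt \<le> F2_value D V P p \<omega> s t xs xt"
  unfolding F1_value_def F2_value_def
proof (intro Inf_superset_mono subsetI)
  fix v
  assume "v \<in> {ereal (\<Sum>i\<in>V. \<omega> i * d i) | d z lam \<rho> \<Phi> \<Psi>.
    F2_feasible D V P p s t xs xt d z lam \<rho> \<Phi> \<Psi>}"
  then obtain d z lam \<rho> \<Phi> \<Psi> where v: "v = ereal (\<Sum>i\<in>V. \<omega> i * d i)"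
    and "F2_feasible D V P p s t xs xt d z lam \<rho> \<Phi> \<Psi>"
    by blast
  then have "F1_feasible D V P p s t xs xt d z lam"
    using assms by (intro F2_feasible_imp_F1_feasible)
  with v show "v \<in> {ereal (\<Sum>i\<in>V. \<omega> i * d i) | d z lam. F1_feasible D V P p s t xs xt d z lam}"
    by blast
qed

theorem proposition15:
  fixes P :: "nat \<Rightarrow> (real^'n) set" and m s t :: nat and p :: "nat \<Rightarrow> ereal"
    and \<omega> :: "nat \<Rightarrow> real" and xs xt :: "real^'n" and \<zeta> \<zeta>' :: ereal
  assumes "polyhedral_subdivision {1..m} P"
    and "\<And>i. i \<in> {1..m} \<Longrightarrow> 1 \<le> p i \<and> p i \<le> \<infinity>"
    and "\<And>i. i \<in> {1..m} \<Longrightarrow> 0 < \<omega> i"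
    and "s \<in> {1..m}" and "t \<in> {1..m}" and "s \<noteq> t"
    and "xs \<in> P s" and "xt \<in> P t"
    and "\<zeta> = SPP_F1_relaxation {1..m} P p \<omega> s t xs xt"
    and "\<zeta>' = SPP_F2_relaxation {1..m} P p \<omega> s t xs xt"
  shows "0 \<le> \<zeta> \<and> 0 \<le> \<zeta>' \<and> \<zeta> \<le> \<zeta>'"
proof -
  have "\<zeta> \<le> \<zeta>'"
    unfolding assms(9,10) SPP_F1_relaxation_def SPP_F2_relaxation_def
    using assms(2,4,5) by (intro F1_value_le_F2_value) auto
  moreover have "0 \<le> \<zeta>"
    unfolding assms(9) SPP_F1_relaxation_def
    using assms(3) by (intro F1_value_nonneg) (simp add: less_imp_le)
  \<comment> \<open>\<open>0 \<le> \<zeta>'\<close> follows by transitivity through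
    \<open>\<zeta>\<close>.\<close>
  ultimately show ?thesis
    by auto
qed

end
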